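(* Let $N,M\ge 1$, let $\mathcal{A}$ be a finite nonempty set of real $N\times M$ matrices and let $\mathcal{B}$ be a finite nonempty set of real $M\times N$ matrices. The system $$x(n)=A_nB_n\,x(n-1),\qquad n=1,2,\ldots,\quad x(n)\in\mathbb{R}^N,\ A_n\in\mathcal{A},\ B_n\in\mathcal{B},$$ is path-independent periodically stabilizable in the class of all perturbations $\mathcal{A}$ and controls $\mathcal{B}$ if and only if $\eta(\mathcal{A},\mathcal{B})<1$.
   Context: The system is called path-independent periodically stabilizable if there exists a (universal) periodic sequence $\{B_n\}_{n\ge1}$ with $B_n\in\mathcal{B}$ (i.e. for some integer $p\ge1$, $B_{n+p}=B_n$ for all $n\ge1$) such that, for each sequence $\{A_n\}_{n\ge1}$ with $A_n\in\mathcal{A}$ and each initial condition $x(0)\in\mathbb{R}^N$, $x(n)=A_nB_n\cdots A_1B_1x(0)\to0$ as $n\to\infty$. The upper minimax joint spectral radius of the pair $\{\mathcal{A},\mathcal{B}\}$ is $$\eta(\mathcal{A},\mathcal{B})=\lim_{n\to\infty}\eta_n(\mathcal{A},\mathcal{B})^{1/n},\qquad \eta_n(\mathcal{A},\mathcal{B})=\min_{B_1,\ldots,B_n\in\mathcal{B}}\ \max_{A_1,\ldots,A_n\in\mathcal{A}}\|A_nB_n\cdots A_1B_1\|,$$ where $\|\cdot\|$ is a norm on the space of real $N\times N$ matrices; the limit exists and does not depend on the choice of the norm. *)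

theory Defs
  imports "HOL-Analysis.Analysis"
begin

text \<open>
  A real \<open>N \<times> M\<close> matrix has type \<^typ>\<open>real^'m^'n\<close> with \<open>N = CARD('n)\<close> rows and \<open>M = CARD('m)\<close>
  columns. Sequences \<open>(A\<^sub>n)\<close>, \<open>(B\<^sub>n)\<close> with \<open>n \<ge> 1\<close> are functions on \<^typ>\<open>nat\<close> whose value at 0 is
  never used.
\<close>

primrec mat_prod :: "(nat \<Rightarrow> real^'m^'n) \<Rightarrow> (nat \<Rightarrow> real^'n^'m) \<Rightarrow> nat \<Rightarrow> real^'n^'n" where
  "mat_prod A B 0 = mat 1"
| "mat_prod A B (Suc n) = A (Suc n) ** B (Suc n) ** mat_prod A B n"

primrec trajectory ::
  "(nat \<Rightarrow> real^'m^'n) \<Rightarrow> (nat \<Rightarrow> real^'n^'m) \<Rightarrow> real^'n \<Rightarrow> nat \<Rightarrow> real^'n" where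
  "trajectory A B x0 0 = x0"
| "trajectory A B x0 (Suc n) = (A (Suc n) ** B (Suc n)) *v trajectory A B x0 n"

lemma trajectory_eq_mat_prod: "trajectory A B x0 n = mat_prod A B n *v x0"
  by (induction n) (simp_all add: matrix_vector_mul_assoc)

definition path_independent_periodically_stabilizable ::
  "(real^'m^'n) set \<Rightarrow> (real^'n^'m) set \<Rightarrow> bool" where
  "path_independent_periodically_stabilizable \<A> \<B> \<longleftrightarrow>
     (\<exists>B. (\<forall>n\<ge>1. B n \<in> \<B>) \<and> (\<exists>p\<ge>1. \<forall>n\<ge>1. B (n + p) = B n) \<and>
          (\<forall>A. (\<forall>n\<ge>1. A n \<in> \<A>) \<longrightarrow> (\<forall>x0. trajectory A B x0 \<longlonglongrightarrow> 0)))"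

text \<open>An arbitrary norm, not necessarily submultiplicative; nonnegativity follows from the axioms.\<close>

definition is_norm :: "('v::real_vector \<Rightarrow> real) \<Rightarrow> bool" where
  "is_norm \<nu> \<longleftrightarrow>
     (\<forall>x. \<nu> x = 0 \<longleftrightarrow> x = 0) \<and>
     (\<forall>c x. \<nu> (c *\<^sub>R x) = \<bar>c\<bar> * \<nu> x) \<and>
     (\<forall>x y. \<nu> (x + y) \<le> \<nu> x + \<nu> y)"

text \<open>
  The choices \<open>(A\<^sub>1, \<dots>, A\<^sub>n)\<close> and \<open>(B\<^sub>1, \<dots>, B\<^sub>n)\<close> are extensional functions on \<open>{1..n}\<close>, so that for
  finite nonempty sets of matrices the minimum and the maximum are taken over finite nonempty sets.
\<close>

definition minimax_norm ::
  "(real^'n^'n \<Rightarrow> real) \<Rightarrow> (real^'m^'n) set \<Rightarrow> (real^'n^'m) set \<Rightarrow> nat \<Rightarrow> real" where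
  "minimax_norm \<nu> \<A> \<B> n =
     (MIN B \<in> {1..n} \<rightarrow>\<^sub>E \<B>. MAX A \<in> {1..n} \<rightarrow>\<^sub>E \<A>. \<nu> (mat_prod A B n))"

definition upper_minimax_jsr ::
  "(real^'n^'n \<Rightarrow> real) \<Rightarrow> (real^'m^'n) set \<Rightarrow> (real^'n^'m) set \<Rightarrow> real" where
  "upper_minimax_jsr \<nu> \<A> \<B> = lim (\<lambda>n. root n (minimax_norm \<nu> \<A> \<B> n))"

end

theory Submission
  imports Defs
begin

text \<open>
  For the operator norm the minimax norms are submultiplicative in \<open>n\<close>, so their \<open>n\<close>-th roots
  converge to their infimum, and every other norm gives the same limit. If this limit is below 1,
  some \<open>n\<close> has minimax norm below 1, and repeating an optimal block of \<open>n\<close> controls stabilizes the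
  system. Conversely, if a periodic control sequence works, every perturbation sequence
  contracts by \<open>1/2\<close> at some multiple of the period; by compactness of the space of perturbation
  sequences this happens within a uniform time, so all long products are uniformly small.
\<close>

section \<open>Norms on finite-dimensional spaces\<close>

lemma is_norm_zero: "is_norm \<nu> \<Longrightarrow> \<nu> 0 = 0"
  by (simp add: is_norm_def)

lemma is_norm_triangle: "is_norm \<nu> \<Longrightarrow> \<nu> (x + y) \<le> \<nu> x + \<nu> y"
  by (simp add: is_norm_def)

lemma is_norm_minus:
  assumes "is_norm \<nu>"
  shows "\<nu> (- x) = \<nu> x"
proof -
  have "\<nu> ((-1) *\<^sub>R x) = \<bar>-1\<bar> * \<nu> x"
    using assms unfolding is_norm_def by blast
  then show ?thesis by simp
qed

lemma is_norm_nonneg: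
  assumes "is_norm \<nu>"
  shows "0 \<le> \<nu> x"
proof -
  show ?thesis
    using is_norm_triangle[OF assms, of x "- x"]
    by (simp add: is_norm_minus[OF assms] is_norm_zero[OF assms])
qed

lemma is_norm_sum_le:
  assumes "is_norm \<nu>" "finite S"
  shows "\<nu> (\<Sum>i\<in>S. f i) \<le> (\<Sum>i\<in>S. \<nu> (f i))"
  using assms(2)
proof induction
  case empty
  show ?case by (simp add: is_norm_zero[OF assms(1)])
next
  case (insert i S)
  then show ?case using is_norm_triangle[OF assms(1), of "f i" "sum f S"] by simp
qed

text \<open>Expanding \<open>x\<close> in the standard basis and using that coordinates are at most
  \<open>norm x\<close> bounds \<open>\<nu> x\<close> by the sum of the values of
  \<open>\<nu>\<close> on the basis. The summand 1 in the constant makes its positivity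
  immediate.\<close>

lemma is_norm_upper_bound:
  fixes \<nu> :: "'v::euclidean_space \<Rightarrow> real"
  assumes "is_norm \<nu>"
  obtains C where "C > 0" "\<And>x. \<nu> x \<le> C * norm x"
proof
  let ?C = "1 + (\<Sum>b\<in>Basis. \<nu> b)"
  have nonneg: "0 \<le> (\<Sum>b\<in>Basis. \<nu> b)"
    by (intro sum_nonneg is_norm_nonneg[OF assms])
  then show "?C > 0" by simp
  fix x
  have "\<nu> x = \<nu> (\<Sum>b\<in>Basis. (x \<bullet> b) *\<^sub>R b)"
    by (simp add: euclidean_representation)
  also have "\<dots> \<le> (\<Sum>b\<in>Basis. \<nu> ((x \<bullet> b) *\<^sub>R b))"
    by (rule is_norm_sum_le[OF assms]) simp
  also have "\<dots> = (\<Sum>b\<in>Basis. \<bar>x \<bullet> b\<bar> * \<nu> b)"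
    using assms by (simp add: is_norm_def)
  also have "\<dots> \<le> (\<Sum>b\<in>Basis. norm x * \<nu> b)"
    by (intro sum_mono mult_right_mono Basis_le_norm is_norm_nonneg[OF assms])
  also have "\<dots> \<le> ?C * norm x"
    by (simp add: sum_distrib_left[symmetric] algebra_simps)
  finally show "\<nu> x \<le> ?C * norm x" .
qed

text \<open>The triangle inequality, used in both directions, together with the upper bound makes
  \<open>\<nu>\<close> Lipschitz.\<close>

lemma continuous_on_is_norm:
  fixes \<nu> :: "'v::euclidean_space \<Rightarrow> real"
  assumes "is_norm \<nu>"
  shows "continuous_on S \<nu>"
proof -
  obtain C where C: "C > 0" "\<And>x. \<nu> x \<le> C * norm x"
    using is_norm_upper_bound[OF assms] by blast
  have le: "\<nu> x - \<nu> y \<le> C * norm (x - y)" for x y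
    using C(2)[of "x - y"] is_norm_triangle[OF assms, of "x - y" y] by simp
  have "C-lipschitz_on S \<nu>"
  proof (rule lipschitz_onI)
    show "dist (\<nu> x) (\<nu> y) \<le> C * dist x y" for x y
      using le[of x y] le[of y x] by (simp add: dist_real_def dist_norm norm_minus_commute abs_le_iff)
  qed (use C in simp)
  then show ?thesis by (rule lipschitz_on_continuous_on)
qed

text \<open>By compactness \<open>\<nu>\<close> attains a minimum on the Euclidean unit sphere. The
  minimum is positive because \<open>\<nu>\<close> vanishes only at 0, and homogeneity carries the
  bound to all vectors.\<close>

lemma is_norm_lower_bound:
  fixes \<nu> :: "'v::euclidean_space \<Rightarrow> real"
  assumes "is_norm \<nu>"
  obtains c where "c > 0" "\<And>x. norm x \<le> c * \<nu> x"
proof -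
  have "sphere (0::'v) 1 \<noteq> {}" by simp
  then obtain x0 :: 'v where x0: "x0 \<in> sphere 0 1" "\<And>x. x \<in> sphere 0 1 \<Longrightarrow> \<nu> x0 \<le> \<nu> x"
    using continuous_attains_inf[OF compact_sphere _ continuous_on_is_norm[OF assms]] by metis
  have "\<nu> x0 \<noteq> 0"
    using x0(1) assms unfolding is_norm_def by force
  with is_norm_nonneg[OF assms, of x0] have pos: "\<nu> x0 > 0" by simp
  show ?thesis
  proof
    show "1 / \<nu> x0 > 0" using pos by simp
    fix x
    show "norm x \<le> 1 / \<nu> x0 * \<nu> x"
    proof (cases "x = 0")
      case True
      then show ?thesis by (simp add: is_norm_zero[OF assms])
    next
      case False
      have "\<nu> x0 \<le> \<nu> ((1 / norm x) *\<^sub>R x)"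
        using False by (intro x0(2)) simp
      also have "\<dots> = \<nu> x / norm x"
        using assms by (simp add: is_norm_def)
      finally show ?thesis using False pos by (simp add: field_simps)
    qed
  qed
qed

lemma is_norm_comparable:
  fixes \<nu> \<nu>' :: "'v::euclidean_space \<Rightarrow> real"
  assumes "is_norm \<nu>" "is_norm \<nu>'"
  obtains C where "C > 0" "\<And>x. \<nu> x \<le> C * \<nu>' x"
proof -
  obtain C where C: "C > 0" "\<And>x. \<nu> x \<le> C * norm x"
    using is_norm_upper_bound[OF assms(1)] by blast
  obtain c where c: "c > 0" "\<And>x. norm x \<le> c * \<nu>' x"
    using is_norm_lower_bound[OF assms(2)] by blast
  have "\<nu> x \<le> (C * c) * \<nu>' x" for x
  proof -
    have "C * norm x \<le> C * (c * \<nu>' x)" using c(2) C(1) by (intro mult_left_mono) auto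
    with C(2)[of x] show ?thesis by (simp add: mult.assoc)
  qed
  then show ?thesis using C(1) c(1) by (intro that[of "C * c"]) auto
qed

section \<open>The operator norm of a matrix\<close>

text \<open>The auxiliary norm in which all estimates are made: unlike an arbitrary
  \<open>\<nu>\<close>, it is known to be submultiplicative and compatible with the action on
  vectors.\<close>

definition mat_onorm :: "real^'m^'n \<Rightarrow> real" where
  "mat_onorm X = onorm ((*v) X)"

lemma norm_mult_vec_le_mat_onorm: "norm (X *v x) \<le> mat_onorm X * norm x"
  unfolding mat_onorm_def by (rule onorm) simp

lemma mat_onorm_nonneg: "0 \<le> mat_onorm X"
  unfolding mat_onorm_def by (rule onorm_pos_le) simp

lemma mat_onorm_mult_le: "mat_onorm (X ** Y) \<le> mat_onorm X * mat_onorm Y"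
proof -
  have "(*v) (X ** Y) = (*v) X \<circ> (*v) Y"
    by (auto simp: matrix_vector_mul_assoc)
  then show ?thesis unfolding mat_onorm_def by (simp add: onorm_compose)
qed

lemma mat_onorm_one_le: "mat_onorm (mat 1 :: real^'n^'n) \<le> 1"
proof -
  have "(*v) (mat 1 :: real^'n^'n) = (\<lambda>x. x)" by auto
  then show ?thesis unfolding mat_onorm_def by (simp add: onorm_id_le)
qed

lemma is_norm_mat_onorm: "is_norm mat_onorm"
  unfolding is_norm_def
proof (intro conjI allI)
  fix X Y :: "real^'m^'n" and c :: real
  show "mat_onorm X = 0 \<longleftrightarrow> X = 0"
    unfolding mat_onorm_def by (auto simp: onorm_eq_0 matrix_eq)
  have "(*v) (c *\<^sub>R X) = (\<lambda>x. c *\<^sub>R (X *v x))"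
    by (auto simp: scaleR_matrix_vector_assoc)
  then show "mat_onorm (c *\<^sub>R X) = \<bar>c\<bar> * mat_onorm X"
    unfolding mat_onorm_def by (simp add: onorm_scaleR)
  have "(*v) (X + Y) = (\<lambda>x. X *v x + Y *v x)"
    by (auto simp: matrix_vector_mult_add_rdistrib)
  then show "mat_onorm (X + Y) \<le> mat_onorm X + mat_onorm Y"
    unfolding mat_onorm_def by (simp add: onorm_triangle)
qed

lemma mat_onorm_tendsto_zero:
  fixes X :: "nat \<Rightarrow> real^'m^'n"
  assumes "\<And>x. (\<lambda>n. X n *v x) \<longlonglongrightarrow> 0"
  shows "(\<lambda>n. mat_onorm (X n)) \<longlonglongrightarrow> 0"
proof -
  have "X \<longlonglongrightarrow> 0"
  proof (intro vec_tendstoI)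
    fix i j
    \<comment> \<open>Applying \<open>X n\<close> to a unit vector reads off a column, so pointwise
      convergence gives convergence of every entry.\<close>
    have "(\<lambda>n. (X n *v axis j 1) $ i) \<longlonglongrightarrow> 0 $ i"
      by (intro tendsto_vec_nth assms)
    then show "(\<lambda>n. X n $ i $ j) \<longlonglongrightarrow> 0 $ i $ j"
      by (simp add: matrix_vector_mult_basis column_def)
  qed
  moreover have "continuous_on UNIV (mat_onorm :: real^'m^'n \<Rightarrow> real)"
    by (rule continuous_on_is_norm[OF is_norm_mat_onorm])
  ultimately have "(\<lambda>n. mat_onorm (X n)) \<longlonglongrightarrow> mat_onorm (0 :: real^'m^'n)"
    by (auto intro: continuous_on_tendsto_compose)
  then show ?thesis
    by (simp add: is_norm_zero[OF is_norm_mat_onorm])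
qed

section \<open>Submultiplicative sequences\<close>

text \<open>The multiplicative form of Fekete's lemma; the terms may vanish, so logarithms are avoided.\<close>

lemma submultiplicative_root_converges:
  fixes u :: "nat \<Rightarrow> real"
  assumes nonneg: "\<And>n. 0 \<le> u n" and submult: "\<And>m n. u (m + n) \<le> u m * u n"
  obtains L where "(\<lambda>n. root n (u n)) \<longlonglongrightarrow> L" "\<And>n. 1 \<le> n \<Longrightarrow> L \<le> root n (u n)"
proof -
  define L where "L = (INF n\<in>{1..}. root n (u n))"
  have bdd: "bdd_below ((\<lambda>n. root n (u n)) ` {1..})"
    by (rule bdd_belowI[of _ 0]) (auto intro: real_root_ge_zero nonneg)
  have L_le: "L \<le> root n (u n)" if "1 \<le> n" for n
    unfolding L_def using that by (intro cINF_lower[OF bdd]) simp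
  have "0 \<le> L"
    unfolding L_def by (intro cINF_greatest) (auto intro: real_root_ge_zero nonneg)
  have upper: "eventually (\<lambda>n. root n (u n) < a) sequentially" if "L < a" for a
  proof -
    \<comment> \<open>The gap between \<open>t\<close> and \<open>a\<close> later absorbs the factor
      \<open>root n M\<close>, which tends to 1.\<close>
    obtain t where t: "L < t" "t < a" using dense[OF \<open>L < a\<close>] by blast
    with \<open>0 \<le> L\<close> have "0 < t" by simp
    obtain k where k: "k \<ge> 1" "root k (u k) < t"
      using t(1) cINF_less_iff[OF _ bdd, of t] unfolding L_def by auto
    have "u k = root k (u k) ^ k" using k(1) nonneg by simp
    also have "\<dots> \<le> t ^ k" using k nonneg by (intro power_mono) (auto intro: real_root_ge_zero)
    finally have uk: "u k \<le> t ^ k" .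
    \<comment> \<open>\<open>M\<close> dominates \<open>u r / t ^ r\<close> for every remainder
      \<open>r < k\<close>; the added 1 makes it positive, so that its roots tend to 1.\<close>
    define M where "M = 1 + (\<Sum>r<k. u r / t ^ r)"
    have "0 \<le> (\<Sum>r<k. u r / t ^ r)"
      using \<open>0 < t\<close> nonneg by (intro sum_nonneg) simp
    then have "0 < M" unfolding M_def by simp
    have mult: "u (q * k + r) \<le> t ^ (q * k) * u r" for q r
    proof (induction q)
      case (Suc q)
      have "u (Suc q * k + r) \<le> u k * u (q * k + r)"
        using submult[of k "q * k + r"] by (simp add: add.assoc)
      also have "\<dots> \<le> t ^ k * (t ^ (q * k) * u r)"
        using Suc uk nonneg \<open>0 < t\<close> by (intro mult_mono) auto
      finally show ?case by (simp add: power_add mult.assoc)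
    qed simp
    have bound: "u n \<le> M * t ^ n" for n
    proof -
      define r where "r = n mod k"
      have "r < k" unfolding r_def using k(1) by simp
      have n: "n div k * k + r = n" unfolding r_def by simp
      have "u r / t ^ r \<le> (\<Sum>r<k. u r / t ^ r)"
        using \<open>r < k\<close> \<open>0 < t\<close> nonneg by (intro member_le_sum) auto
      then have "u r / t ^ r \<le> M" unfolding M_def by simp
      then have ur: "u r \<le> M * t ^ r" using \<open>0 < t\<close> by (simp add: field_simps)
      have "u n \<le> t ^ (n div k * k) * u r" using mult[of "n div k" r] n by simp
      also have "\<dots> \<le> t ^ (n div k * k) * (M * t ^ r)"
        using ur \<open>0 < t\<close> by (intro mult_left_mono) auto
      also have "\<dots> = M * t ^ (n div k * k + r)" by (simp add: power_add)
      finally show ?thesis using n by simp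
    qed
    have "(\<lambda>n. root n M * t) \<longlonglongrightarrow> 1 * t"
      by (intro tendsto_intros LIMSEQ_root_const \<open>0 < M\<close>)
    then have "eventually (\<lambda>n. root n M * t < a) sequentially"
      using t(2) by (intro order_tendstoD(2)[of _ "1 * t"]) auto
    with eventually_gt_at_top[of 0] show ?thesis
    proof eventually_elim
      case (elim n)
      have "root n (u n) \<le> root n (M * t ^ n)"
        using elim(1) bound by simp
      also have "\<dots> = root n M * t"
        using elim(1) \<open>0 < t\<close> by (simp add: real_root_mult real_root_power_cancel)
      finally show ?case using elim(2) by simp
    qed
  qed
  have "(\<lambda>n. root n (u n)) \<longlonglongrightarrow> L"
  proof (rule order_tendstoI)
    fix a assume "a < L"
    show "eventually (\<lambda>n. a < root n (u n)) sequentially"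
      using eventually_ge_at_top[of 1]
      by eventually_elim (use L_le \<open>a < L\<close> in force)
  qed (rule upper)
  then show ?thesis using L_le that by blast
qed

lemma geometric_div_tendsto_zero:
  fixes \<rho> :: real
  assumes "0 \<le> \<rho>" "\<rho> < 1" "0 < T"
  shows "(\<lambda>n. C * \<rho> ^ (n div T)) \<longlonglongrightarrow> 0"
proof -
  have "filterlim (\<lambda>n. n div T) at_top sequentially"
    unfolding filterlim_at_top eventually_sequentially
  proof (intro allI exI[of _ "_ * T"] impI)
    fix Z n assume "Z * T \<le> n"
    then show "Z \<le> n div T" using assms(3) by (simp add: less_eq_div_iff_mult_less_eq)
  qed
  then have "(\<lambda>n. \<rho> ^ (n div T)) \<longlonglongrightarrow> 0"
    using filterlim_compose[OF LIMSEQ_realpow_zero[OF assms(1,2)]] by blast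
  then show ?thesis by (rule tendsto_mult_right_zero)
qed

section \<open>The minimax norms\<close>

lemma mat_prod_cong:
  assumes "\<And>i. i \<in> {1..n} \<Longrightarrow> A i = A' i" "\<And>i. i \<in> {1..n} \<Longrightarrow> B i = B' i"
  shows "mat_prod A B n = mat_prod A' B' n"
  using assms by (induction n) auto

lemma mat_prod_add:
  "mat_prod A B (m + n) = mat_prod (\<lambda>i. A (m + i)) (\<lambda>i. B (m + i)) n ** mat_prod A B m"
  by (induction n) (simp_all add: matrix_mul_assoc)

text \<open>The topology on sequences is the product topology, and the matrix product is polynomial
  in finitely many coordinates. This makes the contraction sets of the compactness argument
  open.\<close>

lemma continuous_on_mat_prod:
  fixes B :: "nat \<Rightarrow> real^'n^'m"
  shows "continuous_on UNIV (\<lambda>A. mat_prod A B n)"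
proof (induction n)
  case (Suc n)
  have mult: "continuous_on UNIV (\<lambda>A. f A ** g A)"
    if "continuous_on UNIV f" "continuous_on UNIV g"
    for f :: "(nat \<Rightarrow> real^'m^'n) \<Rightarrow> real^'k^'n" and g :: "(nat \<Rightarrow> real^'m^'n) \<Rightarrow> real^'l^'k"
    unfolding matrix_matrix_mult_def
    by (intro continuous_intros that)
  show ?case by (simp, intro mult Suc continuous_on_product_coordinates continuous_on_const)
qed simp

text \<open>Trades the minimum and maximum over extensional functions for quantifiers over ordinary
  sequences. Restricting a sequence to \<open>{1..n}\<close> leaves the product unchanged, since no
  other index is read.\<close>

lemma minimax_norm_le_iff:
  fixes \<A> :: "(real^'m^'n) set" and \<B> :: "(real^'n^'m) set"
  assumes "finite \<A>" "\<A> \<noteq> {}" "finite \<B>" "\<B> \<noteq> {}"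
  shows "minimax_norm \<nu> \<A> \<B> n \<le> r \<longleftrightarrow>
    (\<exists>B. (\<forall>i\<in>{1..n}. B i \<in> \<B>) \<and>
      (\<forall>A. (\<forall>i\<in>{1..n}. A i \<in> \<A>) \<longrightarrow> \<nu> (mat_prod A B n) \<le> r))" (is "_ \<longleftrightarrow> ?R")
proof -
  have fin: "finite ({1..n} \<rightarrow>\<^sub>E \<A>)" "{1..n} \<rightarrow>\<^sub>E \<A> \<noteq> {}" "finite ({1..n} \<rightarrow>\<^sub>E \<B>)" "{1..n} \<rightarrow>\<^sub>E \<B> \<noteq> {}"
    using assms by (auto intro!: finite_PiE simp: PiE_eq_empty_iff)
  have "minimax_norm \<nu> \<A> \<B> n \<le> r \<longleftrightarrow>
    (\<exists>B\<in>{1..n} \<rightarrow>\<^sub>E \<B>. \<forall>A\<in>{1..n} \<rightarrow>\<^sub>E \<A>. \<nu> (mat_prod A B n) \<le> r)"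
    unfolding minimax_norm_def using fin by (subst Min_le_iff) auto
  also have "\<dots> \<longleftrightarrow> ?R"
  proof
    assume "\<exists>B\<in>{1..n} \<rightarrow>\<^sub>E \<B>. \<forall>A\<in>{1..n} \<rightarrow>\<^sub>E \<A>. \<nu> (mat_prod A B n) \<le> r"
    then obtain B where B: "B \<in> {1..n} \<rightarrow>\<^sub>E \<B>"
      "\<And>A. A \<in> {1..n} \<rightarrow>\<^sub>E \<A> \<Longrightarrow> \<nu> (mat_prod A B n) \<le> r" by blast
    have "\<nu> (mat_prod A B n) \<le> r" if "\<forall>i\<in>{1..n}. A i \<in> \<A>" for A
    proof -
      have "mat_prod A B n = mat_prod (restrict A {1..n}) B n"
        by (rule mat_prod_cong) auto
      with B(2)[of "restrict A {1..n}"] that show ?thesis by auto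
    qed
    with B(1) show ?R by (intro exI[of _ B]) (auto dest: PiE_mem)
  next
    assume ?R
    then obtain B where B: "\<And>i. i\<in>{1..n} \<Longrightarrow> B i \<in> \<B>"
      "\<And>A. \<forall>i\<in>{1..n}. A i \<in> \<A> \<Longrightarrow> \<nu> (mat_prod A B n) \<le> r" by blast
    have "mat_prod A (restrict B {1..n}) n = mat_prod A B n" for A :: "nat \<Rightarrow> real^'m^'n"
      by (rule mat_prod_cong) auto
    with B show "\<exists>B\<in>{1..n} \<rightarrow>\<^sub>E \<B>. \<forall>A\<in>{1..n} \<rightarrow>\<^sub>E \<A>. \<nu> (mat_prod A B n) \<le> r"
      by (intro bexI[of _ "restrict B {1..n}"]) (auto simp: PiE_iff)
  qed
  finally show ?thesis .
qed

context
  fixes \<A> :: "(real^'m^'n) set" and \<B> :: "(real^'n^'m) set"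
  assumes sets: "finite \<A>" "\<A> \<noteq> {}" "finite \<B>" "\<B> \<noteq> {}"
begin

lemma minimax_norm_attained:
  obtains B where "\<And>i. i \<in> {1..n} \<Longrightarrow> B i \<in> \<B>"
    "\<And>A. (\<And>i. i \<in> {1..n} \<Longrightarrow> A i \<in> \<A>) \<Longrightarrow> \<nu> (mat_prod A B n) \<le> minimax_norm \<nu> \<A> \<B> n"
proof -
  have "minimax_norm \<nu> \<A> \<B> n \<le> minimax_norm \<nu> \<A> \<B> n" by simp
  then show ?thesis
    unfolding minimax_norm_le_iff[OF sets, of \<nu> n "minimax_norm \<nu> \<A> \<B> n"]
    using that by blast
qed

lemma minimax_norm_nonneg:
  assumes "is_norm \<nu>"
  shows "0 \<le> minimax_norm \<nu> \<A> \<B> n"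
proof -
  obtain a where "a \<in> \<A>" using sets(2) by blast
  then obtain B where "\<nu> (mat_prod (\<lambda>_. a) B n) \<le> minimax_norm \<nu> \<A> \<B> n"
    using minimax_norm_attained[of n \<nu>] by metis
  with is_norm_nonneg[OF assms] show ?thesis by (rule order_trans)
qed

text \<open>Controls that are optimal for \<open>\<nu>'\<close> are admissible, though perhaps not
  optimal, for \<open>\<nu>\<close>.\<close>

lemma minimax_norm_mono:
  assumes "\<And>X. \<nu> X \<le> C * \<nu>' X" "0 \<le> C"
  shows "minimax_norm \<nu> \<A> \<B> n \<le> C * minimax_norm \<nu>' \<A> \<B> n"
proof -
  obtain B where "\<And>i. i \<in> {1..n} \<Longrightarrow> B i \<in> \<B>"
    "\<And>A. (\<And>i. i \<in> {1..n} \<Longrightarrow> A i \<in> \<A>) \<Longrightarrow> \<nu>' (mat_prod A B n) \<le> minimax_norm \<nu>' \<A> \<B> n"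
    using minimax_norm_attained by blast
  with assms show ?thesis
    by (subst minimax_norm_le_iff[OF sets]) (meson mult_left_mono order_trans)
qed

text \<open>Optimal controls for lengths \<open>m\<close> and \<open>n\<close> are concatenated.
  Both blocks are fixed before the perturbations are chosen, so each part of the product obeys its
  own bound whatever the perturbations are.\<close>

lemma minimax_onorm_submult:
  "minimax_norm mat_onorm \<A> \<B> (m + n) \<le>
    minimax_norm mat_onorm \<A> \<B> m * minimax_norm mat_onorm \<A> \<B> n"
proof -
  let ?\<mu> = "minimax_norm mat_onorm \<A> \<B>"
  obtain B1 where B1: "\<And>i. i \<in> {1..m} \<Longrightarrow> B1 i \<in> \<B>"
    "\<And>A. (\<And>i. i \<in> {1..m} \<Longrightarrow> A i \<in> \<A>) \<Longrightarrow> mat_onorm (mat_prod A B1 m) \<le> ?\<mu> m"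
    using minimax_norm_attained by blast
  obtain B2 where B2: "\<And>i. i \<in> {1..n} \<Longrightarrow> B2 i \<in> \<B>"
    "\<And>A. (\<And>i. i \<in> {1..n} \<Longrightarrow> A i \<in> \<A>) \<Longrightarrow> mat_onorm (mat_prod A B2 n) \<le> ?\<mu> n"
    using minimax_norm_attained by blast
  define B where "B i = (if i \<le> m then B1 i else B2 (i - m))" for i
  show ?thesis
    unfolding minimax_norm_le_iff[OF sets]
  proof (intro exI[of _ B] conjI allI impI ballI)
    fix i assume "i \<in> {1..m + n}"
    then have "i \<in> {1..m} \<or> i - m \<in> {1..n} \<and> \<not> i \<le> m" by auto
    then show "B i \<in> \<B>" using B1(1) B2(1) by (auto simp: B_def)
  next
    fix A assume A: "\<forall>i\<in>{1..m + n}. A i \<in> \<A>"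
    have 1: "mat_prod A B m = mat_prod A B1 m"
      by (rule mat_prod_cong) (auto simp: B_def)
    have 2: "mat_prod (\<lambda>i. A (m + i)) (\<lambda>i. B (m + i)) n = mat_prod (\<lambda>i. A (m + i)) B2 n"
      by (rule mat_prod_cong) (auto simp: B_def)
    have "mat_onorm (mat_prod A B (m + n)) \<le>
        mat_onorm (mat_prod (\<lambda>i. A (m + i)) B2 n) * mat_onorm (mat_prod A B1 m)"
      unfolding mat_prod_add 1 2 by (rule mat_onorm_mult_le)
    also have "\<dots> \<le> ?\<mu> n * ?\<mu> m"
      using A by (intro mult_mono B1(2) B2(2) mat_onorm_nonneg minimax_norm_nonneg is_norm_mat_onorm) auto
    finally show "mat_onorm (mat_prod A B (m + n)) \<le> ?\<mu> m * ?\<mu> n" by (simp add: mult.commute)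
  qed
qed

text \<open>Submultiplicativity gives a limit \<open>L\<close>, bounding all roots from below, for
  the operator norm. Comparing \<open>\<nu>\<close> with that norm costs constant factors only, and
  their \<open>n\<close>-th roots tend to 1; hence \<open>\<nu>\<close> yields the same
  limit.\<close>

lemma upper_minimax_jsr_props:
  assumes "is_norm \<nu>"
  shows "(\<lambda>n. root n (minimax_norm mat_onorm \<A> \<B> n)) \<longlonglongrightarrow> upper_minimax_jsr \<nu> \<A> \<B>"
    and "1 \<le> n \<Longrightarrow> upper_minimax_jsr \<nu> \<A> \<B> \<le> root n (minimax_norm mat_onorm \<A> \<B> n)"
proof -
  let ?\<mu> = "minimax_norm mat_onorm \<A> \<B>" and ?\<eta> = "minimax_norm \<nu> \<A> \<B>"
  obtain L where L: "(\<lambda>n. root n (?\<mu> n)) \<longlonglongrightarrow> L" "\<And>n. 1 \<le> n \<Longrightarrow> L \<le> root n (?\<mu> n)"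
    using submultiplicative_root_converges[of ?\<mu>] minimax_onorm_submult
      minimax_norm_nonneg[OF is_norm_mat_onorm] by metis
  obtain C where C: "C > 0" "\<And>X. \<nu> X \<le> C * mat_onorm X"
    using is_norm_comparable[OF assms is_norm_mat_onorm] by blast
  obtain c where c: "c > 0" "\<And>X. mat_onorm X \<le> c * \<nu> X"
    using is_norm_comparable[OF is_norm_mat_onorm assms] by blast
  have "(\<lambda>n. root n (?\<eta> n)) \<longlonglongrightarrow> L"
  proof (rule tendsto_sandwich)
    show "eventually (\<lambda>n. root n (1 / c) * root n (?\<mu> n) \<le> root n (?\<eta> n)) sequentially"
      using eventually_gt_at_top[of 0]
    proof eventually_elim
      case (elim n)
      have "1 / c * ?\<mu> n \<le> ?\<eta> n"
        using minimax_norm_mono[OF c(2), where n=n] c(1) by (simp add: field_simps)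
      then show ?case using elim by (simp add: real_root_mult[symmetric])
    qed
    show "eventually (\<lambda>n. root n (?\<eta> n) \<le> root n C * root n (?\<mu> n)) sequentially"
      using eventually_gt_at_top[of 0]
    proof eventually_elim
      case (elim n)
      then show ?case
        using minimax_norm_mono[OF C(2), where n=n] C(1) by (simp add: real_root_mult[symmetric])
    qed
    show "(\<lambda>n. root n (1 / c) * root n (?\<mu> n)) \<longlonglongrightarrow> L"
      using tendsto_mult[OF LIMSEQ_root_const[of "1 / c"] L(1)] c(1) by simp
    show "(\<lambda>n. root n C * root n (?\<mu> n)) \<longlonglongrightarrow> L"
      using tendsto_mult[OF LIMSEQ_root_const[of C] L(1)] C(1) by simp
  qed
  then have "upper_minimax_jsr \<nu> \<A> \<B> = L"
    unfolding upper_minimax_jsr_def by (rule limI)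
  with L show "(\<lambda>n. root n (?\<mu> n)) \<longlonglongrightarrow> upper_minimax_jsr \<nu> \<A> \<B>"
    and "1 \<le> n \<Longrightarrow> upper_minimax_jsr \<nu> \<A> \<B> \<le> root n (?\<mu> n)" by auto
qed

section \<open>Decay under periodic controls\<close>

text \<open>A crude exponential bound for the products too short to contain a full contracting
  block. \<open>D\<close> is at least 1, so that its powers increase.\<close>

lemma mat_prod_growth:
  obtains D where "1 \<le> D"
    "\<And>A B n. (\<And>i. 1 \<le> i \<Longrightarrow> A i \<in> \<A>) \<Longrightarrow> (\<And>i. 1 \<le> i \<Longrightarrow> B i \<in> \<B>) \<Longrightarrow>
      mat_onorm (mat_prod A B n) \<le> D ^ n"
proof -
  define D where "D = 1 + (\<Sum>(a, b)\<in>\<A> \<times> \<B>. mat_onorm (a ** b))"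
  have "0 \<le> (\<Sum>(a, b)\<in>\<A> \<times> \<B>. mat_onorm (a ** b))"
    by (intro sum_nonneg) (auto simp: mat_onorm_nonneg)
  then have "1 \<le> D" by (simp add: D_def)
  have step: "mat_onorm (a ** b) \<le> D" if "a \<in> \<A>" "b \<in> \<B>" for a b
  proof -
    have "mat_onorm (a ** b) \<le> (\<Sum>(a, b)\<in>\<A> \<times> \<B>. mat_onorm (a ** b))"
      using member_le_sum[of "(a, b)" "\<A> \<times> \<B>" "\<lambda>(a, b). mat_onorm (a ** b)"] that sets
      by (auto simp: mat_onorm_nonneg)
    then show ?thesis by (simp add: D_def)
  qed
  have "mat_onorm (mat_prod A B n) \<le> D ^ n"
    if AB: "\<And>i. 1 \<le> i \<Longrightarrow> A i \<in> \<A>" "\<And>i. 1 \<le> i \<Longrightarrow> B i \<in> \<B>" for A B n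
  proof (induction n)
    case 0
    show ?case using mat_onorm_one_le by simp
  next
    case (Suc n)
    have "mat_onorm (mat_prod A B (Suc n)) \<le>
        mat_onorm (A (Suc n) ** B (Suc n)) * mat_onorm (mat_prod A B n)"
      by (simp add: mat_onorm_mult_le)
    also have "\<dots> \<le> D * D ^ n"
      using Suc step AB \<open>1 \<le> D\<close> by (intro mult_mono mat_onorm_nonneg) auto
    finally show ?case by simp
  qed
  with \<open>1 \<le> D\<close> show ?thesis using that by blast
qed

text \<open>Any long product is cut into blocks of norm at most \<open>\<rho>\<close>: periodicity of the controls makes
  the hypothesis applicable again after each block, whose length is a multiple of \<open>p\<close>.\<close>

lemma periodic_decay:
  assumes B: "\<And>i. 1 \<le> i \<Longrightarrow> B i \<in> \<B>" and period: "\<And>i. 1 \<le> i \<Longrightarrow> B (i + p) = B i"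
    and "1 \<le> p" "1 \<le> K" "0 \<le> \<rho>" "\<rho> < 1"
    and contr: "\<And>A. (\<And>i. 1 \<le> i \<Longrightarrow> A i \<in> \<A>) \<Longrightarrow>
      \<exists>q\<in>{1..K}. mat_onorm (mat_prod A B (q * p)) \<le> \<rho>"
  obtains C where "\<And>A n. (\<And>i. 1 \<le> i \<Longrightarrow> A i \<in> \<A>) \<Longrightarrow>
      mat_onorm (mat_prod A B n) \<le> C * \<rho> ^ (n div (K * p))"
proof -
  obtain D where D: "1 \<le> D"
    "\<And>A B n. (\<And>i. 1 \<le> i \<Longrightarrow> A i \<in> \<A>) \<Longrightarrow> (\<And>i. 1 \<le> i \<Longrightarrow> B i \<in> \<B>) \<Longrightarrow>
      mat_onorm (mat_prod A B n) \<le> D ^ n"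
    using mat_prod_growth by blast
  let ?T = "K * p"
  have "?T > 0" using assms(3,4) by simp
  have per: "B (q * p + i) = B i" if "1 \<le> i" for q i
  proof (induction q)
    case (Suc q)
    have "B (q * p + i + p) = B (q * p + i)" using that by (intro period) simp
    with Suc show ?case by (simp add: algebra_simps)
  qed simp
  \<comment> \<open>The factor \<open>D ^ ?T\<close> covers all lengths below \<open>?T\<close>,
    where the exponent of \<open>\<rho>\<close> is 0; the induction then removes one contracting
    block at a time, with \<open>A\<close> shifted.\<close>
  have "mat_onorm (mat_prod A B n) \<le> D ^ ?T * \<rho> ^ (n div ?T)"
    if "\<And>i. 1 \<le> i \<Longrightarrow> A i \<in> \<A>" for A n
    using that
  proof (induction n arbitrary: A rule: less_induct)
    case (less n)
    show ?case
    proof (cases "n < ?T")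
      case True
      have "mat_onorm (mat_prod A B n) \<le> D ^ n" using less.prems B by (intro D(2))
      also have "\<dots> \<le> D ^ ?T" using True D(1) by (intro power_increasing) auto
      finally show ?thesis using True by simp
    next
      case False
      obtain q where q: "q \<in> {1..K}" "mat_onorm (mat_prod A B (q * p)) \<le> \<rho>"
        using contr[of A] less.prems by blast
      have qT: "q * p \<le> ?T" "0 < q * p" using q(1) assms(3) by auto
      define k where "k = n - q * p"
      have n: "n = q * p + k" "k < n" using False qT by (linarith | simp add: k_def)+
      \<comment> \<open>The removed block has length at most \<open>?T\<close>, so the quotient by
        \<open>?T\<close> drops by at most one, which the single factor \<open>\<rho>\<close> pays
        for.\<close>
      have "n \<le> k + ?T" using n(1) qT(1) by simp
      then have "n div ?T \<le> (k + ?T) div ?T" by (rule div_le_mono)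
      then have div: "n div ?T \<le> Suc (k div ?T)" using \<open>?T > 0\<close> by simp
      let ?A = "\<lambda>i. A (q * p + i)"
      have shift: "mat_prod ?A (\<lambda>i. B (q * p + i)) k = mat_prod ?A B k"
        by (rule mat_prod_cong) (auto simp: per)
      have "mat_onorm (mat_prod A B n) \<le> mat_onorm (mat_prod ?A B k) * mat_onorm (mat_prod A B (q * p))"
        unfolding n(1) mat_prod_add shift by (rule mat_onorm_mult_le)
      also have "\<dots> \<le> (D ^ ?T * \<rho> ^ (k div ?T)) * \<rho>"
        using less.prems less.IH[OF n(2), of ?A] q(2) D(1) \<open>0 \<le> \<rho>\<close>
        by (intro mult_mono mat_onorm_nonneg) auto
      also have "\<dots> = D ^ ?T * \<rho> ^ Suc (k div ?T)" by simp
      also have "\<dots> \<le> D ^ ?T * \<rho> ^ (n div ?T)"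
        using div D(1) assms(5,6) by (intro mult_left_mono power_decreasing) auto
      finally show ?thesis .
    qed
  qed
  then show ?thesis using that by blast
qed

section \<open>Stabilizability and minimax norms below 1\<close>

lemma stabilizable_if_minimax_lt_1:
  assumes "1 \<le> n" "minimax_norm mat_onorm \<A> \<B> n < 1"
  shows "path_independent_periodically_stabilizable \<A> \<B>"
proof -
  let ?\<rho> = "minimax_norm mat_onorm \<A> \<B> n"
  have "0 \<le> ?\<rho>" by (rule minimax_norm_nonneg[OF is_norm_mat_onorm])
  obtain B0 where B0: "\<And>i. i \<in> {1..n} \<Longrightarrow> B0 i \<in> \<B>"
    "\<And>A. (\<And>i. i \<in> {1..n} \<Longrightarrow> A i \<in> \<A>) \<Longrightarrow> mat_onorm (mat_prod A B0 n) \<le> ?\<rho>"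
    using minimax_norm_attained by blast
  \<comment> \<open>The block \<open>B0\<close> is indexed from 1, hence the shift by one before and
    after \<open>mod\<close>. At index 0 truncated subtraction gives \<open>B0 1\<close>, so
    periodicity is claimed from index 1 on.\<close>
  define B where "B i = B0 (Suc ((i - 1) mod n))" for i
  have "Suc (j mod n) \<in> {1..n}" for j using assms(1) by (simp add: Suc_le_eq)
  then have B: "B i \<in> \<B>" for i unfolding B_def by (intro B0(1))
  have period: "B (i + n) = B i" if "1 \<le> i" for i
  proof -
    have "i + n - 1 = i - 1 + n" using that by simp
    then show ?thesis by (simp add: B_def)
  qed
  \<comment> \<open>Every period is itself a contracting block, so the decay lemma applies with
    \<open>K = 1\<close> and period \<open>n\<close>.\<close>
  have contr: "\<exists>q\<in>{1..1}. mat_onorm (mat_prod A B (q * n)) \<le> ?\<rho>"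
    if "\<And>i. 1 \<le> i \<Longrightarrow> A i \<in> \<A>" for A
  proof -
    have "mat_prod A B n = mat_prod A B0 n"
      by (rule mat_prod_cong) (auto simp: B_def)
    with B0(2)[of A] that show ?thesis by simp
  qed
  obtain C where C: "\<And>A k. (\<And>i. 1 \<le> i \<Longrightarrow> A i \<in> \<A>) \<Longrightarrow> mat_onorm (mat_prod A B k) \<le> C * ?\<rho> ^ (k div (1 * n))"
    using periodic_decay[OF B period assms(1) le_refl \<open>0 \<le> ?\<rho>\<close> assms(2) contr] by metis
  have "trajectory A B x0 \<longlonglongrightarrow> 0" if "\<forall>i\<ge>1. A i \<in> \<A>" for A x0
  proof (rule Lim_null_comparison)
    show "\<forall>\<^sub>F k in sequentially. norm (trajectory A B x0 k) \<le> C * ?\<rho> ^ (k div n) * norm x0"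
    proof (intro always_eventually allI)
      fix k
      have "norm (trajectory A B x0 k) \<le> mat_onorm (mat_prod A B k) * norm x0"
        unfolding trajectory_eq_mat_prod by (rule norm_mult_vec_le_mat_onorm)
      also have "\<dots> \<le> C * ?\<rho> ^ (k div n) * norm x0"
        using C[of A k] that by (intro mult_right_mono) auto
      finally show "norm (trajectory A B x0 k) \<le> C * ?\<rho> ^ (k div n) * norm x0" .
    qed
    show "(\<lambda>k. C * ?\<rho> ^ (k div n) * norm x0) \<longlonglongrightarrow> 0"
      using assms \<open>0 \<le> ?\<rho>\<close> by (intro tendsto_mult_left_zero geometric_div_tendsto_zero) auto
  qed
  with B period assms(1) show ?thesis
    unfolding path_independent_periodically_stabilizable_def by blast
qed

text \<open>Compactness of the space of perturbation sequences makes the time of the first contraction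
  bounded uniformly in the sequence.\<close>

lemma stabilizable_uniform_contraction:
  assumes "1 \<le> p"
    and stable: "\<And>A x0. (\<And>i. 1 \<le> i \<Longrightarrow> A i \<in> \<A>) \<Longrightarrow> trajectory A B x0 \<longlonglongrightarrow> 0"
  obtains K where "1 \<le> K"
    "\<And>A. (\<And>i. 1 \<le> i \<Longrightarrow> A i \<in> \<A>) \<Longrightarrow> \<exists>q\<in>{1..K}. mat_onorm (mat_prod A B (q * p)) \<le> 1 / 2"
proof -
  let ?S = "UNIV \<rightarrow>\<^sub>E \<A> :: (nat \<Rightarrow> real^'m^'n) set"
  define U where "U q = {A. mat_onorm (mat_prod A B (q * p)) < 1 / 2}" for q
  \<comment> \<open>Tychonoff's theorem: a product of finite, hence compact, sets.\<close>
  have "compactin (product_topology (\<lambda>_. euclidean) UNIV) ?S"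
    using sets(1) by (simp add: compactin_PiE finite_imp_compact)
  then have "compact ?S" by (simp add: euclidean_product_topology)
  moreover have "open (U q)" for q
    unfolding U_def
    by (intro open_Collect_less continuous_on_const
        continuous_on_compose2[OF continuous_on_is_norm[OF is_norm_mat_onorm] continuous_on_mat_prod])
      auto
  moreover have "?S \<subseteq> (\<Union>q\<in>{1..}. U q)"
  proof
    fix A assume "A \<in> ?S"
    then have "trajectory A B x \<longlonglongrightarrow> 0" for x by (intro stable) auto
    then have "(\<lambda>n. mat_prod A B n *v x) \<longlonglongrightarrow> 0" for x
      by (simp add: trajectory_eq_mat_prod[abs_def])
    then have "(\<lambda>n. mat_onorm (mat_prod A B n)) \<longlonglongrightarrow> 0"
      by (rule mat_onorm_tendsto_zero)
    then have "eventually (\<lambda>n. mat_onorm (mat_prod A B n) < 1 / 2) sequentially"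
      by (rule order_tendstoD) simp
    then obtain N where N: "\<And>n. N \<le> n \<Longrightarrow> mat_onorm (mat_prod A B n) < 1 / 2"
      unfolding eventually_sequentially by blast
    \<comment> \<open>Smallness at all late times includes a positive multiple of \<open>p\<close>;
      \<open>Suc N\<close> keeps the multiplier at least 1.\<close>
    have "N * 1 \<le> Suc N * p" using assms(1) by (intro mult_mono) auto
    then have "A \<in> U (Suc N)" unfolding U_def using N by simp
    then show "A \<in> (\<Union>q\<in>{1..}. U q)" by force
  qed
  ultimately obtain Q where Q: "Q \<subseteq> {1..}" "finite Q" "?S \<subseteq> (\<Union>q\<in>Q. U q)"
    by (rule compactE_image)
  \<comment> \<open>Inserting 1 makes the maximum well defined and at least 1, whatever the finite
    subcover is.\<close>
  define K where "K = Max (insert 1 Q)"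
  have K: "1 \<le> K" "\<And>q. q \<in> Q \<Longrightarrow> q \<le> K"
    using Q(2) by (auto simp: K_def)
  have "\<exists>q\<in>{1..K}. mat_onorm (mat_prod A B (q * p)) \<le> 1 / 2"
    if A: "\<And>i. 1 \<le> i \<Longrightarrow> A i \<in> \<A>" for A
  proof -
    \<comment> \<open>The value of \<open>A\<close> at 0 is unconstrained, whereas \<open>?S\<close>
      demands membership at every index; the product does not read index 0.\<close>
    have "A(0 := A 1) \<in> ?S" using A by auto
    then obtain q where q: "q \<in> Q" "A(0 := A 1) \<in> U q" using Q(3) by blast
    have "mat_prod (A(0 := A 1)) B (q * p) = mat_prod A B (q * p)"
      by (rule mat_prod_cong) auto
    with q K(2) Q(1) show ?thesis by (intro bexI[of _ q]) (auto simp: U_def)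
  qed
  with K(1) show ?thesis using that by blast
qed

text \<open>The stabilizing controls decay at a rate uniform in the perturbations. Their first
  \<open>n\<close> terms are one competitor in the minimum, so the minimax norm falls below 1 for
  large \<open>n\<close>.\<close>

lemma minimax_lt_1_if_stabilizable:
  assumes "path_independent_periodically_stabilizable \<A> \<B>"
  obtains n where "1 \<le> n" "minimax_norm mat_onorm \<A> \<B> n < 1"
proof -
  obtain B p where B: "\<And>i. 1 \<le> i \<Longrightarrow> B i \<in> \<B>" and p: "1 \<le> p" "\<And>i. 1 \<le> i \<Longrightarrow> B (i + p) = B i"
    and stable: "\<And>A x0. (\<And>i. 1 \<le> i \<Longrightarrow> A i \<in> \<A>) \<Longrightarrow> trajectory A B x0 \<longlonglongrightarrow> 0"
    using assms unfolding path_independent_periodically_stabilizable_def by metis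
  obtain K where K: "1 \<le> K"
    "\<And>A. (\<And>i. 1 \<le> i \<Longrightarrow> A i \<in> \<A>) \<Longrightarrow> \<exists>q\<in>{1..K}. mat_onorm (mat_prod A B (q * p)) \<le> 1 / 2"
    using stabilizable_uniform_contraction[OF p(1) stable] by blast
  obtain C where C: "\<And>A n. (\<And>i. 1 \<le> i \<Longrightarrow> A i \<in> \<A>) \<Longrightarrow>
      mat_onorm (mat_prod A B n) \<le> C * (1 / 2) ^ (n div (K * p))"
  proof (rule periodic_decay[of B p K "1 / 2"])
    show "1 \<le> i \<Longrightarrow> B i \<in> \<B>" "1 \<le> i \<Longrightarrow> B (i + p) = B i" for i
      using B p(2) by auto
    show "\<exists>q\<in>{1..K}. mat_onorm (mat_prod A B (q * p)) \<le> 1 / 2"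
      if "\<And>i. 1 \<le> i \<Longrightarrow> A i \<in> \<A>" for A
      using K(2) that by blast
  qed (use p(1) K(1) in auto)
  have "(\<lambda>n. C * (1 / 2) ^ (n div (K * p))) \<longlonglongrightarrow> 0"
    using K(1) p(1) by (intro geometric_div_tendsto_zero) auto
  then have "eventually (\<lambda>n. C * (1 / 2) ^ (n div (K * p)) < 1) sequentially"
    by (rule order_tendstoD) simp
  then have "eventually (\<lambda>n. C * (1 / 2) ^ (n div (K * p)) < 1 \<and> 1 \<le> n) sequentially"
    using eventually_ge_at_top[of 1] by (rule eventually_conj)
  then obtain n where n: "C * (1 / 2) ^ (n div (K * p)) < 1" "1 \<le> n"
    by (auto simp: eventually_sequentially)
  have "minimax_norm mat_onorm \<A> \<B> n \<le> C * (1 / 2) ^ (n div (K * p))"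
    unfolding minimax_norm_le_iff[OF sets]
  proof (intro exI[of _ B] conjI allI impI ballI)
    fix A assume A: "\<forall>i\<in>{1..n}. A i \<in> \<A>"
    \<comment> \<open>The decay bound concerns infinite admissible sequences, so the finite choice
      is continued beyond \<open>n\<close> by \<open>A 1\<close>, which lies in \<open>\<A>\<close>
      because \<open>1 \<le> n\<close>.\<close>
    define A' where "A' i = (if i \<le> n then A i else A 1)" for i
    have "mat_prod A B n = mat_prod A' B n"
      by (rule mat_prod_cong) (auto simp: A'_def)
    moreover have "A' i \<in> \<A>" if "1 \<le> i" for i
      using A n(2) that by (auto simp: A'_def)
    ultimately show "mat_onorm (mat_prod A B n) \<le> C * (1 / 2) ^ (n div (K * p))"
      using C[of A' n] by simp
  qed (use B in auto)
  with n show ?thesis by (intro that[of n]) auto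
qed

end

theorem theorem4p4:
  fixes \<A> :: "(real^'m^'n) set" and \<B> :: "(real^'n^'m) set"
    and \<nu> :: "real^'n^'n \<Rightarrow> real"
  assumes "finite \<A>" "\<A> \<noteq> {}" and "finite \<B>" "\<B> \<noteq> {}"
    and "is_norm \<nu>"
  shows "path_independent_periodically_stabilizable \<A> \<B> \<longleftrightarrow> upper_minimax_jsr \<nu> \<A> \<B> < 1"
proof
  assume "path_independent_periodically_stabilizable \<A> \<B>"
  then obtain n where "1 \<le> n" "minimax_norm mat_onorm \<A> \<B> n < 1"
    using minimax_lt_1_if_stabilizable[OF assms(1-4)] by blast
  then have "root n (minimax_norm mat_onorm \<A> \<B> n) < 1" by simp
  \<comment> \<open>A single root below 1 suffices, since the limit lies below every root.\<close>
  with upper_minimax_jsr_props(2)[OF assms \<open>1 \<le> n\<close>]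
  show "upper_minimax_jsr \<nu> \<A> \<B> < 1" by simp
next
  assume "upper_minimax_jsr \<nu> \<A> \<B> < 1"
  then have "eventually (\<lambda>n. root n (minimax_norm mat_onorm \<A> \<B> n) < 1) sequentially"
    using order_tendstoD(2)[OF upper_minimax_jsr_props(1)[OF assms]] by blast
  then have "eventually (\<lambda>n. root n (minimax_norm mat_onorm \<A> \<B> n) < 1 \<and> 1 \<le> n) sequentially"
    using eventually_ge_at_top[of 1] by (rule eventually_conj)
  then obtain n where "root n (minimax_norm mat_onorm \<A> \<B> n) < 1" "1 \<le> n"
    by (auto simp: eventually_sequentially)
  then show "path_independent_periodically_stabilizable \<A> \<B>"
    by (intro stabilizable_if_minimax_lt_1[OF assms(1-4), of n]) auto
qed

end
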